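(* Let $\xi>0$ and put $\mu=\sqrt{\alpha_{12}}\,W(\xi)$. Then the functions $$\theta_1(x,t)=-\frac{D_\infty\operatorname{erf}(\xi)}{\operatorname{erf}(\xi)+\frac{k_1}{h_0\sqrt{\pi\alpha_1}}}\left(1-\frac{\operatorname{erf}\left(\frac{x}{2\sqrt{\alpha_1 t}}\right)}{\operatorname{erf}(\xi)}\right)\quad (0<x<s(t),\ t>0),$$ $$\theta_2(x,t)=\frac{\theta_0\operatorname{erf}(\mu)}{\operatorname{erfc}(\mu)}\left(\frac{\operatorname{erf}\left(\frac{x}{2\sqrt{\alpha_2 t}}\right)}{\operatorname{erf}(\mu)}-1\right)\quad (x>r(t),\ t>0),$$ $$s(t)=2\xi\sqrt{\alpha_1 t},\qquad r(t)=2\mu\sqrt{\alpha_2 t}\quad (t>0)$$ are a solution of the free boundary problem (P) if and only if $\xi$ is a solution of the equation $$F(x)=\frac{l\sqrt{\pi}}{D_\infty c_1}\,G(x),\qquad x>0.$$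
   Context: Parameters: $\rho,k_1,k_2,c_1,c_2,l,\gamma,\theta_0,D_\infty,h_0>0$ and $0<\epsilon<1$ are real constants; $\alpha_i=\frac{k_i}{\rho c_i}$ for $i=1,2$, and $\alpha_{12}=\frac{\alpha_1}{\alpha_2}$. As usual $\operatorname{erf}(x)=\frac{2}{\sqrt\pi}\int_0^x e^{-y^2}\,dy$ and $\operatorname{erfc}=1-\operatorname{erf}$. Problem (P) (two-phase Stefan problem with mushy zone and convective boundary condition): find $\theta_1,\theta_2,s,r$ such that - $\alpha_1\theta_{1,xx}=\theta_{1,t}$ for $0<x<s(t)$, $t>0$; - $\alpha_2\theta_{2,xx}=\theta_{2,t}$ for $x>r(t)$, $t>0$; - $s(0)=r(0)=0$; - $\theta_1(s(t),t)=\theta_2(r(t),t)=0$ for $t>0$; - $\theta_2(x,0)=\theta_2(+\infty,t)=\theta_0$ for $x>0$, $t>0$; - $k_1\theta_{1,x}(s(t),t)-k_2\theta_{2,x}(r(t),t)=\rho l[\epsilon\dot s(t)+(1-\epsilon)\dot r(t)]$ for $t>0$; - $\theta_{1,x}(s(t),t)\,(r(t)-s(t))=\gamma$ for $t>0$; - $k_1\theta_{1,x}(0,t)=\frac{h_0}{\sqrt t}\left(\theta_1(0,t)+D_\infty\right)$ for $t>0$. Values at the boundaries $x=0$, $x=s(t)$, $x=r(t)$, at $t=0$ and at $x=+\infty$ are understood as limits. Auxiliary functions, for $x>0$: $$W(x)=x+\frac{\gamma\sqrt\pi}{2D_\infty}e^{x^2}\left(\operatorname{erf}(x)+\frac{k_1}{h_0\sqrt{\alpha_1\pi}}\right),$$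 $$F(x)=\frac{e^{-x^2}}{\operatorname{erf}(x)+\frac{k_1}{h_0\sqrt{\alpha_1\pi}}}-\frac{\theta_0\sqrt{k_2c_2}}{D_\infty\sqrt{k_1c_1}}\,\frac{\exp\left(-\alpha_{12}W^2(x)\right)}{\operatorname{erfc}\left(\sqrt{\alpha_{12}}W(x)\right)},$$ $$G(x)=x+\frac{(1-\epsilon)\gamma\sqrt\pi}{2D_\infty}e^{x^2}\left(\operatorname{erf}(x)+\frac{k_1}{h_0\sqrt{\alpha_1\pi}}\right).$$ *)

theory Defs
  imports "HOL-Analysis.Analysis"
begin

text \<open>The interval integral is oriented, so the formula is also the right one for \<open>x < 0\<close>.\<close>

definition erf :: "real \<Rightarrow> real" where
  "erf x = 2 / sqrt pi * (LBINT y=ereal 0..ereal x. exp (- (y\<^sup>2)))"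

definition erfc :: "real \<Rightarrow> real" where
  "erfc x = 1 - erf x"

definition dx :: "(real \<Rightarrow> real \<Rightarrow> real) \<Rightarrow> real \<Rightarrow> real \<Rightarrow> real" where
  "dx u x t = deriv (\<lambda>y. u y t) x"

definition dt :: "(real \<Rightarrow> real \<Rightarrow> real) \<Rightarrow> real \<Rightarrow> real \<Rightarrow> real" where
  "dt u x t = deriv (\<lambda>\<tau>. u x \<tau>) t"

text \<open>\<open>deriv\<close> is total, so the existence of the derivatives is demanded separately.\<close>

definition satisfies_heat_equation_at ::
    "real \<Rightarrow> (real \<Rightarrow> real \<Rightarrow> real) \<Rightarrow> real \<Rightarrow> real \<Rightarrow> bool" where
  "satisfies_heat_equation_at \<alpha> u x t \<longleftrightarrow>
     (\<lambda>y. u y t) differentiable (at x) \<and>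
     (\<lambda>y. dx u y t) differentiable (at x) \<and>
     (\<lambda>\<tau>. u x \<tau>) differentiable (at t) \<and>
     \<alpha> * dx (dx u) x t = dt u x t"

text \<open>
  The temperatures \<open>\<theta>\<^sub>1\<close>, \<open>\<theta>\<^sub>2\<close> are constrained only on the open regions \<open>0 < x < s t\<close> and
  \<open>r t < x\<close> (with \<open>t > 0\<close>), and \<open>s\<close>, \<open>r\<close> only for \<open>t > 0\<close>; every value on the boundary of
  these domains is a one-sided limit, in \<open>x\<close> for fixed \<open>t\<close> or in \<open>t\<close> for fixed \<open>x\<close>.
  The requirement \<open>0 < s t\<close> makes the first region nonempty, so that the limits at
  \<open>x = 0\<close> and \<open>x = s t\<close> are taken inside it.
\<close>

definition stefan_mushy_solution ::
    "real \<Rightarrow> real \<Rightarrow> real \<Rightarrow> real \<Rightarrow> real \<Rightarrow> real \<Rightarrow> real \<Rightarrow> real \<Rightarrow> real \<Rightarrow> real \<Rightarrow> real \<Rightarrow>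
     (real \<Rightarrow> real \<Rightarrow> real) \<Rightarrow> (real \<Rightarrow> real \<Rightarrow> real) \<Rightarrow> (real \<Rightarrow> real) \<Rightarrow> (real \<Rightarrow> real) \<Rightarrow> bool" where
  "stefan_mushy_solution \<rho> k\<^sub>1 k\<^sub>2 c\<^sub>1 c\<^sub>2 l \<gamma> \<theta>\<^sub>0 D h\<^sub>0 \<epsilon> \<theta>\<^sub>1 \<theta>\<^sub>2 s r \<longleftrightarrow>
     (\<forall>t>0. 0 < s t) \<and>
     (\<forall>t>0. \<forall>x. 0 < x \<and> x < s t \<longrightarrow> satisfies_heat_equation_at (k\<^sub>1 / (\<rho> * c\<^sub>1)) \<theta>\<^sub>1 x t) \<and>
     (\<forall>t>0. \<forall>x. r t < x \<longrightarrow> satisfies_heat_equation_at (k\<^sub>2 / (\<rho> * c\<^sub>2)) \<theta>\<^sub>2 x t) \<and>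
     (s \<longlongrightarrow> 0) (at_right 0) \<and> (r \<longlongrightarrow> 0) (at_right 0) \<and>
     (\<forall>t>0. ((\<lambda>x. \<theta>\<^sub>1 x t) \<longlongrightarrow> 0) (at_left (s t)) \<and>
            ((\<lambda>x. \<theta>\<^sub>2 x t) \<longlongrightarrow> 0) (at_right (r t))) \<and>
     (\<forall>x>0. ((\<lambda>t. \<theta>\<^sub>2 x t) \<longlongrightarrow> \<theta>\<^sub>0) (at_right 0)) \<and>
     (\<forall>t>0. ((\<lambda>x. \<theta>\<^sub>2 x t) \<longlongrightarrow> \<theta>\<^sub>0) at_top) \<and>
     (\<forall>t>0. s differentiable (at t) \<and> r differentiable (at t) \<and>
        (\<exists>p q. ((\<lambda>x. dx \<theta>\<^sub>1 x t) \<longlongrightarrow> p) (at_left (s t)) \<and>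
               ((\<lambda>x. dx \<theta>\<^sub>2 x t) \<longlongrightarrow> q) (at_right (r t)) \<and>
               k\<^sub>1 * p - k\<^sub>2 * q = \<rho> * l * (\<epsilon> * deriv s t + (1 - \<epsilon>) * deriv r t) \<and>
               p * (r t - s t) = \<gamma>)) \<and>
     (\<forall>t>0. \<exists>u p. ((\<lambda>x. \<theta>\<^sub>1 x t) \<longlongrightarrow> u) (at_right 0) \<and>
                  ((\<lambda>x. dx \<theta>\<^sub>1 x t) \<longlongrightarrow> p) (at_right 0) \<and>
                  k\<^sub>1 * p = h\<^sub>0 / sqrt t * (u + D))"

definition W_fun :: "real \<Rightarrow> real \<Rightarrow> real \<Rightarrow> real \<Rightarrow> real \<Rightarrow> real \<Rightarrow> real" where
  "W_fun \<gamma> D k\<^sub>1 h\<^sub>0 \<alpha>\<^sub>1 x =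
     x + \<gamma> * sqrt pi / (2 * D) * exp (x\<^sup>2) * (erf x + k\<^sub>1 / (h\<^sub>0 * sqrt (\<alpha>\<^sub>1 * pi)))"

definition F_fun ::
    "real \<Rightarrow> real \<Rightarrow> real \<Rightarrow> real \<Rightarrow> real \<Rightarrow> real \<Rightarrow> real \<Rightarrow> real \<Rightarrow> real \<Rightarrow> real \<Rightarrow> real \<Rightarrow> real" where
  "F_fun \<gamma> \<theta>\<^sub>0 D k\<^sub>1 k\<^sub>2 c\<^sub>1 c\<^sub>2 h\<^sub>0 \<alpha>\<^sub>1 \<alpha>\<^sub>1\<^sub>2 x =
     exp (- (x\<^sup>2)) / (erf x + k\<^sub>1 / (h\<^sub>0 * sqrt (\<alpha>\<^sub>1 * pi)))
     - \<theta>\<^sub>0 * sqrt (k\<^sub>2 * c\<^sub>2) / (D * sqrt (k\<^sub>1 * c\<^sub>1))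
       * (exp (- \<alpha>\<^sub>1\<^sub>2 * (W_fun \<gamma> D k\<^sub>1 h\<^sub>0 \<alpha>\<^sub>1 x)\<^sup>2)
          / erfc (sqrt \<alpha>\<^sub>1\<^sub>2 * W_fun \<gamma> D k\<^sub>1 h\<^sub>0 \<alpha>\<^sub>1 x))"

definition G_fun :: "real \<Rightarrow> real \<Rightarrow> real \<Rightarrow> real \<Rightarrow> real \<Rightarrow> real \<Rightarrow> real \<Rightarrow> real" where
  "G_fun \<epsilon> \<gamma> D k\<^sub>1 h\<^sub>0 \<alpha>\<^sub>1 x =
     x + (1 - \<epsilon>) * \<gamma> * sqrt pi / (2 * D) * exp (x\<^sup>2)
         * (erf x + k\<^sub>1 / (h\<^sub>0 * sqrt (\<alpha>\<^sub>1 * pi)))"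

end

theory Submission
  imports Defs "HOL-Probability.Distributions" "HOL-Real_Asymp.Real_Asymp"
begin

text \<open>
  Both temperatures have the form \<open>A + B erf (x / (2 sqrt (\<alpha> t)))\<close>, a function of the
  similarity variable, and both fronts are multiples of \<open>sqrt t\<close>. Such functions solve the heat
  equation, and the constants are chosen so that the Dirichlet, initial, mushy-zone and convective
  conditions hold for every \<open>\<xi> > 0\<close>. In the remaining flux condition both sides are
  multiples of \<open>1 / sqrt t\<close>; dividing by \<open>k\<^sub>1 D / sqrt (\<pi> \<alpha>\<^sub>1 t)\<close> turns it, at each
  single time, into the equation for \<open>\<xi>\<close>.
\<close>

section \<open>The error function: derivative, monotonicity, limit and upper bound\<close>

lemma has_real_derivative_erf:
  "(erf has_real_derivative 2 / sqrt pi * exp (- (x\<^sup>2))) (at x)"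
proof -
  \<comment> \<open>The interval has to contain the base point 0 of the integral and have x in its
    interior, so that the derivative within it is the full derivative. This choice does both for
    either sign of x.\<close>
  define a where "a = - \<bar>x\<bar> - 1"
  define b where "b = \<bar>x\<bar> + 1"
  have "((\<lambda>u. LBINT y=ereal 0..ereal u. exp (- (y\<^sup>2))) has_vector_derivative exp (- (x\<^sup>2)))
          (at x within {a..b})"
    by (rule interval_integral_FTC2) (auto simp: a_def b_def intro!: continuous_intros)
  moreover have "at x within {a..b} = at x"
    by (rule at_within_interior) (auto simp: a_def b_def)
  ultimately have "((\<lambda>u. LBINT y=ereal 0..ereal u. exp (- (y\<^sup>2))) has_real_derivative exp (- (x\<^sup>2)))
          (at x)"
    by (simp add: has_real_derivative_iff_has_vector_derivative)
  from DERIV_cmult[OF this, of "2 / sqrt pi"] show ?thesis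
    by (simp add: erf_def[abs_def])
qed

lemmas has_real_derivative_erf_compose [derivative_intros] =
  has_real_derivative_erf [THEN DERIV_chain2]

lemma isCont_erf: "isCont erf x"
  using has_real_derivative_erf by (rule DERIV_isCont)

lemmas tendsto_erf [tendsto_intros] = isCont_tendsto_compose [OF isCont_erf]

lemma erf_0 [simp]: "erf 0 = 0"
  by (simp add: erf_def)

lemma erf_strict_mono: "x < y \<Longrightarrow> erf x < erf y"
  by (rule DERIV_pos_imp_increasing) (auto intro!: has_real_derivative_erf)

lemma erf_pos: "0 < x \<Longrightarrow> 0 < erf x"
  using erf_strict_mono[of 0 x] by simp

text \<open>The Gaussian integral over the half-line is \<open>sqrt pi / 2\<close> by
  \<open>gaussian_moment_0\<close>, and the factor \<open>2 / sqrt pi\<close> normalises it to 1.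
  The truncated integrals converge to it because the integrand is integrable.\<close>

lemma tendsto_erf_at_top: "(erf \<longlongrightarrow> 1) at_top"
proof -
  let ?g = "\<lambda>x::real. indicator {0..} x *\<^sub>R exp (- x\<^sup>2)"
  have "((\<lambda>y. \<integral>x. indicator {..y} x *\<^sub>R ?g x \<partial>lborel) \<longlongrightarrow> (\<integral>x. ?g x \<partial>lborel)) at_top"
    using gaussian_moment_0 by (intro tendsto_integral_at_top) (auto simp: has_bochner_integral_iff)
  then have lim: "((\<lambda>y. \<integral>x. indicator {..y} x *\<^sub>R ?g x \<partial>lborel) \<longlongrightarrow> sqrt pi / 2) at_top"
    unfolding has_bochner_integral_integral_eq[OF gaussian_moment_0] .
  have "\<forall>\<^sub>F y in at_top.
          2 / sqrt pi * (\<integral>x. indicator {..y} x *\<^sub>R ?g x \<partial>lborel) = erf y"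
    using eventually_ge_at_top[of 0]
  proof eventually_elim
    case (elim y)
    have "(LBINT x=ereal 0..ereal y. exp (- (x\<^sup>2))) = (LBINT x:{0..y}. exp (- (x\<^sup>2)))"
      using elim by (intro interval_integral_Icc)
    also have "\<dots> = (\<integral>x. indicator {..y} x *\<^sub>R ?g x \<partial>lborel)"
      unfolding set_lebesgue_integral_def
      by (intro Bochner_Integration.integral_cong) (auto simp: indicator_def)
    finally show ?case by (simp add: erf_def)
  qed
  moreover have "((\<lambda>y. 2 / sqrt pi * (\<integral>x. indicator {..y} x *\<^sub>R ?g x \<partial>lborel)) \<longlongrightarrow> 1) at_top"
    using tendsto_mult_left[OF lim, of "2 / sqrt pi"] by simp
  ultimately show ?thesis
    by (rule Lim_transform_eventually[rotated])
qed

text \<open>Passing to the limit gives only a weak bound, so it is taken at \<open>x + 1\<close>;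
  strict monotonicity between x and \<open>x + 1\<close> restores strictness.\<close>

lemma erf_less_1: "erf x < 1"
proof -
  have "\<forall>\<^sub>F y in at_top. erf (x + 1) \<le> erf y"
    using eventually_ge_at_top[of "x + 1"]
    by eventually_elim (metis erf_strict_mono order_le_less)
  then have "erf (x + 1) \<le> 1"
    by (intro tendsto_lowerbound[OF tendsto_erf_at_top]) auto
  with erf_strict_mono[of x "x + 1"] show ?thesis by simp
qed

lemma erfc_pos: "0 < erfc x"
  using erf_less_1[of x] by (simp add: erfc_def)

section \<open>Similarity solutions of the heat equation\<close>

definition similarity :: "real \<Rightarrow> real \<Rightarrow> real \<Rightarrow> real \<Rightarrow> real \<Rightarrow> real" where
  "similarity \<alpha> A B x t = A + B * erf (x / (2 * sqrt (\<alpha> * t)))"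

text \<open>The factor \<open>1 / sqrt (pi * \<alpha> * t)\<close> is the product of
  \<open>2 / sqrt pi\<close> from the derivative of \<open>erf\<close> and
  \<open>1 / (2 * sqrt (\<alpha> * t))\<close> from the inner derivative.\<close>

definition similarity_dx :: "real \<Rightarrow> real \<Rightarrow> real \<Rightarrow> real \<Rightarrow> real" where
  "similarity_dx \<alpha> B x t = B * exp (- ((x / (2 * sqrt (\<alpha> * t)))\<^sup>2)) / sqrt (pi * \<alpha> * t)"

lemma similarity_has_derivative_x:
  assumes "0 < \<alpha>" "0 < t"
  shows "((\<lambda>y. similarity \<alpha> A B y t) has_real_derivative similarity_dx \<alpha> B x t) (at x)"
  unfolding similarity_def similarity_dx_def using assms
  by (auto intro!: derivative_eq_intros simp: real_sqrt_mult mult_ac)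

text \<open>The result is kept as a multiple of \<open>similarity_dx\<close>, as is the time
  derivative below. The heat equation then amounts to comparing the two coefficients: \<alpha> times
  \<open>x / (2 * \<alpha> * t)\<close> is \<open>x / (2 * t)\<close>.\<close>

lemma similarity_dx_has_derivative_x:
  assumes "0 < \<alpha>" "0 < t"
  shows "((\<lambda>y. similarity_dx \<alpha> B y t) has_real_derivative
           - (x / (2 * \<alpha> * t)) * similarity_dx \<alpha> B x t) (at x)"
proof -
  define c where "c = 2 * sqrt (\<alpha> * t)"
  have "c * c = 4 * \<alpha> * t" "c \<noteq> 0"
    using assms by (auto simp: c_def)
  then have eq: "- (2 * (x / c) * (1 / c)) = - (x / (2 * \<alpha> * t))"
    using assms by (simp add: divide_simps)
  have "((\<lambda>y. B * exp (- ((y / c)\<^sup>2))) has_real_derivative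
      - (2 * (x / c) * (1 / c)) * (B * exp (- ((x / c)\<^sup>2)))) (at x)"
    using \<open>c \<noteq> 0\<close> by (auto intro!: derivative_eq_intros)
  from DERIV_cdivide[OF this, of "sqrt (pi * \<alpha> * t)"] show ?thesis
    unfolding similarity_dx_def c_def[symmetric] eq by (simp only: times_divide_eq_right)
qed

lemma similarity_has_derivative_t:
  assumes "0 < \<alpha>" "0 < t"
  shows "((\<lambda>\<tau>. similarity \<alpha> A B x \<tau>) has_real_derivative
           - (x / (2 * t)) * similarity_dx \<alpha> B x t) (at t)"
proof -
  have "((\<lambda>\<tau>. x / (2 * sqrt (\<alpha> * \<tau>))) has_real_derivative - (x / (4 * t * sqrt (\<alpha> * t)))) (at t)"
    using assms by (auto intro!: derivative_eq_intros simp: field_simps mult_less_0_iff)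
  from DERIV_add[OF DERIV_const DERIV_cmult[OF has_real_derivative_erf_compose[OF this]]]
  show ?thesis
    unfolding similarity_def similarity_dx_def by (simp add: real_sqrt_mult mult_ac)
qed

text \<open>Agreement is asked for only near x, because the temperatures are prescribed only inside
  their moving regions.\<close>

lemma dx_eq_similarity_dx:
  assumes "0 < \<alpha>" "0 < t" and "\<forall>\<^sub>F y in nhds x. u y t = similarity \<alpha> A B y t"
  shows "((\<lambda>y. u y t) has_real_derivative similarity_dx \<alpha> B x t) (at x)"
    and "dx u x t = similarity_dx \<alpha> B x t"
proof -
  show *: "((\<lambda>y. u y t) has_real_derivative similarity_dx \<alpha> B x t) (at x)"
    using DERIV_cong_ev[OF refl assms(3) refl] similarity_has_derivative_x[OF assms(1,2)] by blast
  then show "dx u x t = similarity_dx \<alpha> B x t"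
    unfolding dx_def by (rule DERIV_imp_deriv)
qed

lemma similarity_heat_equation:
  assumes "0 < \<alpha>" "0 < t"
    and ev_x: "\<forall>\<^sub>F y in nhds x. u y t = similarity \<alpha> A B y t"
    and ev_t: "\<forall>\<^sub>F \<tau> in nhds t. u x \<tau> = similarity \<alpha> A B x \<tau>"
  shows "satisfies_heat_equation_at \<alpha> u x t"
proof -
  \<comment> \<open>A second derivative needs the first one on a whole neighbourhood of x: agreement
    near x is also agreement near every y close to x.\<close>
  have "\<forall>\<^sub>F y in nhds x. \<forall>\<^sub>F z in nhds y. u z t = similarity \<alpha> A B z t"
    using ev_x by (simp only: eventually_eventually)
  then have "\<forall>\<^sub>F y in nhds x. dx u y t = similarity_dx \<alpha> B y t"
    by eventually_elim (rule dx_eq_similarity_dx(2)[OF assms(1,2)])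
  from DERIV_cong_ev[OF refl this refl] similarity_dx_has_derivative_x[OF assms(1,2)]
  have xx: "((\<lambda>y. dx u y t) has_real_derivative - (x / (2 * \<alpha> * t)) * similarity_dx \<alpha> B x t) (at x)"
    by blast
  from DERIV_cong_ev[OF refl ev_t refl] similarity_has_derivative_t[OF assms(1,2)]
  have t: "((\<lambda>\<tau>. u x \<tau>) has_real_derivative - (x / (2 * t)) * similarity_dx \<alpha> B x t) (at t)"
    by blast
  have "\<alpha> * dx (dx u) x t = dt u x t"
    using DERIV_imp_deriv[OF xx] DERIV_imp_deriv[OF t] assms(1) by (simp add: dx_def[of "dx u"] dt_def)
  with dx_eq_similarity_dx(1)[where u = u, OF assms(1,2) ev_x] xx t show ?thesis
    unfolding satisfies_heat_equation_at_def by (meson real_differentiable_def)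
qed

section \<open>Fronts proportional to the square root of time\<close>

lemma sqrt_front_has_derivative:
  fixes \<sigma> :: "real \<Rightarrow> real"
  assumes "0 < \<alpha>" "0 < t" "\<And>\<tau>. 0 < \<tau> \<Longrightarrow> \<sigma> \<tau> = 2 * c * sqrt (\<alpha> * \<tau>)"
  shows "(\<sigma> has_real_derivative c * sqrt \<alpha> / sqrt t) (at t)"
proof -
  have "((\<lambda>\<tau>. 2 * c * sqrt (\<alpha> * \<tau>)) has_real_derivative c * sqrt \<alpha> / sqrt t) (at t)"
    using assms(1,2) by (auto intro!: derivative_eq_intros simp: real_sqrt_mult field_simps)
  moreover have "\<forall>\<^sub>F \<tau> in nhds t. \<sigma> \<tau> = 2 * c * sqrt (\<alpha> * \<tau>)"
    using eventually_nhds_in_open[of "{0<..}" t] assms(2) by (auto elim!: eventually_mono simp: assms(3))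
  ultimately show ?thesis
    by (subst DERIV_cong_ev[OF refl _ refl]) auto
qed

lemma sqrt_front_tendsto_0:
  fixes \<sigma> :: "real \<Rightarrow> real"
  assumes "\<And>\<tau>. 0 < \<tau> \<Longrightarrow> \<sigma> \<tau> = 2 * c * sqrt (\<alpha> * \<tau>)"
  shows "(\<sigma> \<longlongrightarrow> 0) (at_right 0)"
proof -
  have "((\<lambda>\<tau>. 2 * c * sqrt (\<alpha> * \<tau>)) \<longlongrightarrow> 2 * c * sqrt (\<alpha> * 0)) (at_right 0)"
    by (intro tendsto_intros)
  moreover have "\<forall>\<^sub>F \<tau> in at_right 0. 2 * c * sqrt (\<alpha> * \<tau>) = \<sigma> \<tau>"
    using assms by (auto simp: eventually_at_right_field intro!: exI[of _ 1])
  ultimately show ?thesis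
    by (simp add: tendsto_cong)
qed

section \<open>Continuity and limits of similarity solutions\<close>

lemma similarity_tendsto: "((\<lambda>y. similarity \<alpha> A B y t) \<longlongrightarrow> similarity \<alpha> A B x t) (at x within S)"
  \<comment> \<open>For fixed t the quotient is a product with a constant inverse, hence continuous
    in x for every t; where the square root vanishes, that inverse is 0 by convention.\<close>
  unfolding similarity_def divide_inverse by (intro tendsto_intros)

lemma similarity_dx_tendsto: "((\<lambda>y. similarity_dx \<alpha> B y t) \<longlongrightarrow> similarity_dx \<alpha> B x t) (at x within S)"
  unfolding similarity_dx_def divide_inverse by (intro tendsto_intros)

lemma similarity_tendsto_at_top:
  assumes "0 < \<alpha>" "0 < t"
  shows "((\<lambda>x. similarity \<alpha> A B x t) \<longlongrightarrow> A + B) at_top"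
proof -
  have "filterlim (\<lambda>x. x / (2 * sqrt (\<alpha> * t))) at_top at_top"
    using assms by real_asymp
  from tendsto_add[OF tendsto_const tendsto_mult_left[OF filterlim_compose[OF tendsto_erf_at_top this]]]
  show ?thesis unfolding similarity_def by simp
qed

text \<open>The similarity variable tends to infinity for t to 0 just as it does for x to infinity,
  so the initial value equals the far-field value \<open>A + B\<close>.\<close>

lemma similarity_tendsto_initial:
  assumes "0 < \<alpha>" "0 < x"
  shows "((\<lambda>t. similarity \<alpha> A B x t) \<longlongrightarrow> A + B) (at_right 0)"
proof -
  have "filterlim (\<lambda>t. x / (2 * sqrt (\<alpha> * t))) at_top (at_right 0)"
    using assms by real_asymp
  from tendsto_add[OF tendsto_const tendsto_mult_left[OF filterlim_compose[OF tendsto_erf_at_top this]]]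
  show ?thesis unfolding similarity_def by simp
qed

theorem theorem2p1:
  fixes \<rho> k\<^sub>1 k\<^sub>2 c\<^sub>1 c\<^sub>2 l \<gamma> \<theta>\<^sub>0 D h\<^sub>0 \<epsilon> \<alpha>\<^sub>1 \<alpha>\<^sub>2 \<alpha>\<^sub>1\<^sub>2 \<xi> \<mu> :: real
    and \<theta>\<^sub>1 \<theta>\<^sub>2 :: "real \<Rightarrow> real \<Rightarrow> real" and s r :: "real \<Rightarrow> real"
  assumes "0 < \<rho>" "0 < k\<^sub>1" "0 < k\<^sub>2" "0 < c\<^sub>1" "0 < c\<^sub>2" "0 < l" "0 < \<gamma>" "0 < \<theta>\<^sub>0" "0 < D" "0 < h\<^sub>0"
    and "0 < \<epsilon>" "\<epsilon> < 1"
    and "\<alpha>\<^sub>1 = k\<^sub>1 / (\<rho> * c\<^sub>1)" "\<alpha>\<^sub>2 = k\<^sub>2 / (\<rho> * c\<^sub>2)" "\<alpha>\<^sub>1\<^sub>2 = \<alpha>\<^sub>1 / \<alpha>\<^sub>2"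
    and "0 < \<xi>" and "\<mu> = sqrt \<alpha>\<^sub>1\<^sub>2 * W_fun \<gamma> D k\<^sub>1 h\<^sub>0 \<alpha>\<^sub>1 \<xi>"
    and "\<And>t. 0 < t \<Longrightarrow> s t = 2 * \<xi> * sqrt (\<alpha>\<^sub>1 * t)"
    and "\<And>t. 0 < t \<Longrightarrow> r t = 2 * \<mu> * sqrt (\<alpha>\<^sub>2 * t)"
    and "\<And>x t. 0 < t \<Longrightarrow> 0 < x \<Longrightarrow> x < s t \<Longrightarrow>
           \<theta>\<^sub>1 x t = - (D * erf \<xi> / (erf \<xi> + k\<^sub>1 / (h\<^sub>0 * sqrt (pi * \<alpha>\<^sub>1))))
                       * (1 - erf (x / (2 * sqrt (\<alpha>\<^sub>1 * t))) / erf \<xi>)"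
    and "\<And>x t. 0 < t \<Longrightarrow> r t < x \<Longrightarrow>
           \<theta>\<^sub>2 x t = \<theta>\<^sub>0 * erf \<mu> / erfc \<mu>
                       * (erf (x / (2 * sqrt (\<alpha>\<^sub>2 * t))) / erf \<mu> - 1)"
  shows "stefan_mushy_solution \<rho> k\<^sub>1 k\<^sub>2 c\<^sub>1 c\<^sub>2 l \<gamma> \<theta>\<^sub>0 D h\<^sub>0 \<epsilon> \<theta>\<^sub>1 \<theta>\<^sub>2 s r \<longleftrightarrow>
         F_fun \<gamma> \<theta>\<^sub>0 D k\<^sub>1 k\<^sub>2 c\<^sub>1 c\<^sub>2 h\<^sub>0 \<alpha>\<^sub>1 \<alpha>\<^sub>1\<^sub>2 \<xi>
           = l * sqrt pi / (D * c\<^sub>1) * G_fun \<epsilon> \<gamma> D k\<^sub>1 h\<^sub>0 \<alpha>\<^sub>1 \<xi>"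
proof -

  \<comment> \<open>Constants, their signs and the similarity form of the data\<close>
  define \<kappa> where "\<kappa> = k\<^sub>1 / (h\<^sub>0 * sqrt (\<alpha>\<^sub>1 * pi))"
  define E where "E = erf \<xi> + \<kappa>"
  define W where "W = W_fun \<gamma> D k\<^sub>1 h\<^sub>0 \<alpha>\<^sub>1 \<xi>"
  \<comment> \<open>Multiplying out the given formulas, \<open>erf \<xi>\<close> and
    \<open>erf \<mu>\<close> cancel in the coefficient of the varying \<open>erf\<close>. What
    remains is a constant plus a multiple of \<open>erf\<close> in each phase.\<close>
  define A\<^sub>1 where "A\<^sub>1 = - (D * erf \<xi> / E)"
  define B\<^sub>1 where "B\<^sub>1 = D / E"
  define A\<^sub>2 where "A\<^sub>2 = - (\<theta>\<^sub>0 * erf \<mu> / erfc \<mu>)"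
  define B\<^sub>2 where "B\<^sub>2 = \<theta>\<^sub>0 / erfc \<mu>"
  note pos = assms(1-12,16)
  note s_eq = assms(18) and r_eq = assms(19)
  have \<alpha>_pos: "0 < \<alpha>\<^sub>1" "0 < \<alpha>\<^sub>2" "0 < \<alpha>\<^sub>1\<^sub>2"
    using pos assms(13-15) by auto
  have erf_\<xi>: "0 < erf \<xi>"
    using pos by (intro erf_pos)
  have "0 < \<kappa>" "0 < E"
    using pos \<alpha>_pos erf_\<xi> by (auto simp: \<kappa>_def E_def intro!: add_pos_pos)
  have W_eq: "W = \<xi> + \<gamma> * sqrt pi / (2 * D) * exp (\<xi>\<^sup>2) * E"
    by (simp add: W_def W_fun_def E_def \<kappa>_def)
  have "0 < W"
    unfolding W_eq using pos \<open>0 < E\<close> by (intro add_pos_pos mult_pos_pos divide_pos_pos) auto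
  have \<mu>_eq: "\<mu> = sqrt \<alpha>\<^sub>1\<^sub>2 * W"
    using assms(17) by (simp add: W_def)
  have "0 < \<mu>"
    using \<mu>_eq \<open>0 < W\<close> \<alpha>_pos by simp
  have erf_\<mu>: "0 < erf \<mu>"
    using \<open>0 < \<mu>\<close> by (rule erf_pos)
  \<comment> \<open>Since \<mu> carries the factor \<open>sqrt \<alpha>\<^sub>1\<^sub>2\<close>,
    both fronts have the common scale \<open>sqrt (\<alpha>\<^sub>1 * t)\<close>, with coefficients
    \<xi> and \<open>W\<close>. Their difference and their speeds can then be compared
    directly.\<close>
  have r_W: "r t = 2 * W * sqrt (\<alpha>\<^sub>1 * t)" if "0 < t" for t
    using \<alpha>_pos that by (simp add: r_eq \<mu>_eq assms(15) real_sqrt_mult real_sqrt_divide)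
  have s_pos: "0 < s t" if "0 < t" for t
    using s_eq[OF that] pos \<alpha>_pos that by simp
  have \<theta>\<^sub>1_eq: "\<theta>\<^sub>1 x t = similarity \<alpha>\<^sub>1 A\<^sub>1 B\<^sub>1 x t" if "0 < t" "0 < x" "x < s t" for x t
    unfolding assms(20)[OF that] similarity_def A\<^sub>1_def B\<^sub>1_def E_def[symmetric] \<kappa>_def[symmetric]
      mult.commute[of pi \<alpha>\<^sub>1]
    using erf_\<xi> by (simp add: right_diff_distrib)
  have \<theta>\<^sub>2_eq: "\<theta>\<^sub>2 x t = similarity \<alpha>\<^sub>2 A\<^sub>2 B\<^sub>2 x t" if "0 < t" "r t < x" for x t
    unfolding assms(21)[OF that] similarity_def A\<^sub>2_def B\<^sub>2_def
    using erf_\<mu> by (simp add: right_diff_distrib)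
  have \<theta>\<^sub>1_ev: "\<forall>\<^sub>F y in nhds x. \<theta>\<^sub>1 y t = similarity \<alpha>\<^sub>1 A\<^sub>1 B\<^sub>1 y t" if "0 < t" "0 < x" "x < s t" for x t
    using eventually_nhds_in_open[of "{0<..<s t}" x] that by (auto elim!: eventually_mono simp: \<theta>\<^sub>1_eq)
  have \<theta>\<^sub>2_ev: "\<forall>\<^sub>F y in nhds x. \<theta>\<^sub>2 y t = similarity \<alpha>\<^sub>2 A\<^sub>2 B\<^sub>2 y t" if "0 < t" "r t < x" for x t
    using eventually_nhds_in_open[of "{r t<..}" x] that by (auto elim!: eventually_mono simp: \<theta>\<^sub>2_eq)
  have dx\<^sub>1: "dx \<theta>\<^sub>1 x t = similarity_dx \<alpha>\<^sub>1 B\<^sub>1 x t" if "0 < t" "0 < x" "x < s t" for x t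
    by (rule dx_eq_similarity_dx(2)[where u = \<theta>\<^sub>1, OF \<alpha>_pos(1) that(1) \<theta>\<^sub>1_ev[OF that]])
  have dx\<^sub>2: "dx \<theta>\<^sub>2 x t = similarity_dx \<alpha>\<^sub>2 B\<^sub>2 x t" if "0 < t" "r t < x" for x t
    by (rule dx_eq_similarity_dx(2)[where u = \<theta>\<^sub>2, OF \<alpha>_pos(2) that(1) \<theta>\<^sub>2_ev[OF that]])
  have s_deriv: "(s has_real_derivative \<xi> * sqrt \<alpha>\<^sub>1 / sqrt t) (at t)" if "0 < t" for t
    by (rule sqrt_front_has_derivative[OF \<alpha>_pos(1) that s_eq])
  have r_deriv: "(r has_real_derivative W * sqrt \<alpha>\<^sub>1 / sqrt t) (at t)" if "0 < t" for t
    by (rule sqrt_front_has_derivative[OF \<alpha>_pos(1) that r_W])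
  have s_tendsto: "(s \<longlongrightarrow> s t) (nhds t)" and r_tendsto: "(r \<longlongrightarrow> r t) (nhds t)" if "0 < t" for t
    using DERIV_isCont[OF s_deriv[OF that]] DERIV_isCont[OF r_deriv[OF that]]
    by (auto simp: isCont_def tendsto_at_iff_tendsto_nhds)
  have pos_ev: "\<forall>\<^sub>F \<tau> in nhds t. 0 < \<tau>" if "0 < t" for t :: real
    using eventually_nhds_in_open[of "{0<..}" t] that by simp

  \<comment> \<open>The heat equations in the two regions\<close>
  have heat\<^sub>1: "satisfies_heat_equation_at \<alpha>\<^sub>1 \<theta>\<^sub>1 x t" if "0 < t" "0 < x" "x < s t" for x t
  proof (rule similarity_heat_equation[where u = \<theta>\<^sub>1, OF \<alpha>_pos(1) that(1) \<theta>\<^sub>1_ev[OF that]])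
    \<comment> \<open>The region moves with time. By continuity of the front, a point inside it at
      time t stays inside at all nearby times, so the formula may be differentiated in time.\<close>
    show "\<forall>\<^sub>F \<tau> in nhds t. \<theta>\<^sub>1 x \<tau> = similarity \<alpha>\<^sub>1 A\<^sub>1 B\<^sub>1 x \<tau>"
      using pos_ev[OF that(1)] order_tendstoD(1)[OF s_tendsto[OF that(1)] that(3)]
      by eventually_elim (use that \<theta>\<^sub>1_eq in auto)
  qed
  have heat\<^sub>2: "satisfies_heat_equation_at \<alpha>\<^sub>2 \<theta>\<^sub>2 x t" if "0 < t" "r t < x" for x t
  proof (rule similarity_heat_equation[where u = \<theta>\<^sub>2, OF \<alpha>_pos(2) that(1) \<theta>\<^sub>2_ev[OF that]])
    show "\<forall>\<^sub>F \<tau> in nhds t. \<theta>\<^sub>2 x \<tau> = similarity \<alpha>\<^sub>2 A\<^sub>2 B\<^sub>2 x \<tau>"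
      using pos_ev[OF that(1)] order_tendstoD(2)[OF r_tendsto[OF that(1)] that(2)]
      by eventually_elim (use that \<theta>\<^sub>2_eq in auto)
  qed

  \<comment> \<open>Boundary, initial and far-field limits of the temperatures\<close>
  have left_s: "\<forall>\<^sub>F x in at_left (s t). 0 < x \<and> x < s t"
    and right_0: "\<forall>\<^sub>F x in at_right 0. 0 < x \<and> x < s t" if "0 < t" for t
    using s_pos[OF that] by (auto intro!: eventually_at_leftI eventually_at_rightI)
  have right_r: "\<forall>\<^sub>F x in at_right (r t). r t < x" for t
    by (rule eventually_at_right_less)

  have sim_s: "similarity \<alpha>\<^sub>1 A\<^sub>1 B\<^sub>1 (s t) t = 0" if "0 < t" for t
    using that \<alpha>_pos by (simp add: similarity_def s_eq A\<^sub>1_def B\<^sub>1_def)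
  have sim_r: "similarity \<alpha>\<^sub>2 A\<^sub>2 B\<^sub>2 (r t) t = 0" if "0 < t" for t
    using that \<alpha>_pos by (simp add: similarity_def r_eq A\<^sub>2_def B\<^sub>2_def)
  have AB\<^sub>2: "A\<^sub>2 + B\<^sub>2 = \<theta>\<^sub>0"
  proof -
    have "A\<^sub>2 + B\<^sub>2 = \<theta>\<^sub>0 * erfc \<mu> / erfc \<mu>"
      unfolding A\<^sub>2_def B\<^sub>2_def by (simp add: erfc_def right_diff_distrib diff_divide_distrib)
    then show ?thesis
      using erfc_pos[of \<mu>] by simp
  qed

  have lim_\<theta>\<^sub>1_s: "((\<lambda>x. \<theta>\<^sub>1 x t) \<longlongrightarrow> 0) (at_left (s t))" if "0 < t" for t
  proof (rule Lim_transform_eventually[OF similarity_tendsto[of \<alpha>\<^sub>1 A\<^sub>1 B\<^sub>1 t "s t", unfolded sim_s[OF that]]])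
    show "\<forall>\<^sub>F x in at_left (s t). similarity \<alpha>\<^sub>1 A\<^sub>1 B\<^sub>1 x t = \<theta>\<^sub>1 x t"
      using left_s[OF that] by eventually_elim (use that \<theta>\<^sub>1_eq in auto)
  qed
  have lim_\<theta>\<^sub>1_0: "((\<lambda>x. \<theta>\<^sub>1 x t) \<longlongrightarrow> A\<^sub>1) (at_right 0)" if "0 < t" for t
  proof -
    have "\<forall>\<^sub>F x in at_right 0. similarity \<alpha>\<^sub>1 A\<^sub>1 B\<^sub>1 x t = \<theta>\<^sub>1 x t"
      using right_0[OF that] by eventually_elim (use that \<theta>\<^sub>1_eq in auto)
    from Lim_transform_eventually[OF similarity_tendsto this] show ?thesis
      by (simp add: similarity_def)
  qed
  have lim_\<theta>\<^sub>2_r: "((\<lambda>x. \<theta>\<^sub>2 x t) \<longlongrightarrow> 0) (at_right (r t))" if "0 < t" for t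
  proof (rule Lim_transform_eventually[OF similarity_tendsto[of \<alpha>\<^sub>2 A\<^sub>2 B\<^sub>2 t "r t", unfolded sim_r[OF that]]])
    show "\<forall>\<^sub>F x in at_right (r t). similarity \<alpha>\<^sub>2 A\<^sub>2 B\<^sub>2 x t = \<theta>\<^sub>2 x t"
      using right_r by eventually_elim (use that \<theta>\<^sub>2_eq in auto)
  qed
  have lim_\<theta>\<^sub>2_top: "((\<lambda>x. \<theta>\<^sub>2 x t) \<longlongrightarrow> \<theta>\<^sub>0) at_top" if "0 < t" for t
  proof (rule Lim_transform_eventually[OF similarity_tendsto_at_top[OF \<alpha>_pos(2) that, of A\<^sub>2 B\<^sub>2, unfolded AB\<^sub>2]])
    show "\<forall>\<^sub>F x in at_top. similarity \<alpha>\<^sub>2 A\<^sub>2 B\<^sub>2 x t = \<theta>\<^sub>2 x t"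
      using eventually_gt_at_top[of "r t"] by eventually_elim (use that \<theta>\<^sub>2_eq in auto)
  qed
  have s_0: "(s \<longlongrightarrow> 0) (at_right 0)" and r_0: "(r \<longlongrightarrow> 0) (at_right 0)"
    by (rule sqrt_front_tendsto_0[OF s_eq], assumption) (rule sqrt_front_tendsto_0[OF r_eq], assumption)
  have lim_\<theta>\<^sub>2_initial: "((\<lambda>t. \<theta>\<^sub>2 x t) \<longlongrightarrow> \<theta>\<^sub>0) (at_right 0)" if "0 < x" for x
  proof (rule Lim_transform_eventually[OF similarity_tendsto_initial[OF \<alpha>_pos(2) that, of A\<^sub>2 B\<^sub>2, unfolded AB\<^sub>2]])
    \<comment> \<open>As \<open>r\<close> tends to 0, a fixed x > 0 lies ahead of the front for all
      small times, where the formula for \<open>\<theta>\<^sub>2\<close> is available.\<close>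
    show "\<forall>\<^sub>F t in at_right 0. similarity \<alpha>\<^sub>2 A\<^sub>2 B\<^sub>2 x t = \<theta>\<^sub>2 x t"
      using order_tendstoD(2)[OF r_0 that] eventually_at_right_less
      by eventually_elim (use \<theta>\<^sub>2_eq in auto)
  qed

  \<comment> \<open>Boundary gradients, the mushy-zone condition and the convective
    condition\<close>
  define p where "p t = similarity_dx \<alpha>\<^sub>1 B\<^sub>1 (s t) t" for t
  define q where "q t = similarity_dx \<alpha>\<^sub>2 B\<^sub>2 (r t) t" for t
  have lim_p: "((\<lambda>x. dx \<theta>\<^sub>1 x t) \<longlongrightarrow> p t) (at_left (s t))" if "0 < t" for t
    unfolding p_def
  proof (rule Lim_transform_eventually[OF similarity_dx_tendsto[of \<alpha>\<^sub>1 B\<^sub>1 t]])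
    show "\<forall>\<^sub>F x in at_left (s t). similarity_dx \<alpha>\<^sub>1 B\<^sub>1 x t = dx \<theta>\<^sub>1 x t"
      using left_s[OF that] by eventually_elim (use that dx\<^sub>1 in auto)
  qed
  have lim_q: "((\<lambda>x. dx \<theta>\<^sub>2 x t) \<longlongrightarrow> q t) (at_right (r t))" if "0 < t" for t
    unfolding q_def
  proof (rule Lim_transform_eventually[OF similarity_dx_tendsto[of \<alpha>\<^sub>2 B\<^sub>2 t]])
    show "\<forall>\<^sub>F x in at_right (r t). similarity_dx \<alpha>\<^sub>2 B\<^sub>2 x t = dx \<theta>\<^sub>2 x t"
      using right_r by eventually_elim (use that dx\<^sub>2 in auto)
  qed
  have lim_p0: "((\<lambda>x. dx \<theta>\<^sub>1 x t) \<longlongrightarrow> similarity_dx \<alpha>\<^sub>1 B\<^sub>1 0 t) (at_right 0)" if "0 < t" for t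
  proof (rule Lim_transform_eventually[OF similarity_dx_tendsto[of \<alpha>\<^sub>1 B\<^sub>1 t]])
    show "\<forall>\<^sub>F x in at_right 0. similarity_dx \<alpha>\<^sub>1 B\<^sub>1 x t = dx \<theta>\<^sub>1 x t"
      using right_0[OF that] by eventually_elim (use that dx\<^sub>1 in auto)
  qed

  have p_eq: "p t = D * exp (- (\<xi>\<^sup>2)) / (E * sqrt (pi * \<alpha>\<^sub>1 * t))" if "0 < t" for t
    using that \<alpha>_pos by (simp add: p_def similarity_dx_def s_eq B\<^sub>1_def)
  have q_eq: "q t = \<theta>\<^sub>0 * exp (- (\<mu>\<^sup>2)) / (erfc \<mu> * sqrt (pi * \<alpha>\<^sub>2 * t))" if "0 < t" for t
    using that \<alpha>_pos by (simp add: q_def similarity_dx_def r_eq B\<^sub>2_def)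

  \<comment> \<open>The width of the zone is proportional to \<open>W - \<xi>\<close>, which
    contains \<open>exp (\<xi>\<^sup>2) * E\<close> by the choice of \<open>W_fun\<close>. This is
    inverse to the \<xi>-dependence of the gradient, and the factors \<open>sqrt t\<close> cancel as
    well.\<close>
  have mushy: "p t * (r t - s t) = \<gamma>" if "0 < t" for t
  proof -
    have "r t - s t = \<gamma> * sqrt pi / D * exp (\<xi>\<^sup>2) * E * sqrt (\<alpha>\<^sub>1 * t)"
      unfolding r_W[OF that] s_eq[OF that] W_eq using pos by (simp add: algebra_simps)
    moreover have "exp (- (\<xi>\<^sup>2)) * exp (\<xi>\<^sup>2) = 1"
      by (simp flip: exp_add)
    ultimately show ?thesis
      unfolding p_eq[OF that] using that pos \<alpha>_pos \<open>0 < E\<close> by (simp add: real_sqrt_mult mult_ac)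
  qed

  have convective: "k\<^sub>1 * similarity_dx \<alpha>\<^sub>1 B\<^sub>1 0 t = h\<^sub>0 / sqrt t * (A\<^sub>1 + D)" if "0 < t" for t
  proof -
    \<comment> \<open>Here \<open>E - erf \<xi>\<close> is \<kappa>, whose value balances the
      boundary flux against \<open>h\<^sub>0\<close>.\<close>
    have "A\<^sub>1 + D = D * \<kappa> / E"
      using \<open>0 < E\<close> by (simp add: A\<^sub>1_def field_simps) (simp add: E_def algebra_simps)
    also have "h\<^sub>0 / sqrt t * \<dots> = k\<^sub>1 * similarity_dx \<alpha>\<^sub>1 B\<^sub>1 0 t"
      using pos by (simp add: similarity_dx_def B\<^sub>1_def \<kappa>_def real_sqrt_mult mult_ac)
    finally show ?thesis by simp
  qed

  \<comment> \<open>The flux condition and the equation for \<xi>\<close>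
  let ?F = "F_fun \<gamma> \<theta>\<^sub>0 D k\<^sub>1 k\<^sub>2 c\<^sub>1 c\<^sub>2 h\<^sub>0 \<alpha>\<^sub>1 \<alpha>\<^sub>1\<^sub>2 \<xi>"
  let ?G = "G_fun \<epsilon> \<gamma> D k\<^sub>1 h\<^sub>0 \<alpha>\<^sub>1 \<xi>"
  let ?flux = "\<lambda>t. k\<^sub>1 * p t - k\<^sub>2 * q t = \<rho> * l * (\<epsilon> * deriv s t + (1 - \<epsilon>) * deriv r t)"
  have flux_iff: "?flux t \<longleftrightarrow> ?F = l * sqrt pi / (D * c\<^sub>1) * ?G" if "0 < t" for t
  proof -
    define C where "C = k\<^sub>1 * D / sqrt (pi * \<alpha>\<^sub>1 * t)"
    have "0 < C"
      using that pos \<alpha>_pos by (simp add: C_def)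
    have \<mu>2: "\<mu>\<^sup>2 = \<alpha>\<^sub>1\<^sub>2 * W\<^sup>2"
      using \<alpha>_pos by (simp add: \<mu>_eq power_mult_distrib)
    have F: "?F = exp (- (\<xi>\<^sup>2)) / E - \<theta>\<^sub>0 * sqrt (k\<^sub>2 * c\<^sub>2) / (D * sqrt (k\<^sub>1 * c\<^sub>1)) * (exp (- (\<mu>\<^sup>2)) / erfc \<mu>)"
      by (simp add: F_fun_def E_def \<kappa>_def \<mu>2 flip: W_def \<mu>_eq)
    \<comment> \<open>\<open>G_fun\<close> is the average of the two front coefficients with the
      weights of the flux condition: the term that separates \<open>W\<close> from \<xi> is scaled
      by \<open>1 - \<epsilon>\<close>.\<close>
    have "\<epsilon> * \<xi> + (1 - \<epsilon>) * W = ?G"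
      unfolding W_eq G_fun_def \<kappa>_def[symmetric] E_def[symmetric]
      by (simp add: algebra_simps diff_divide_distrib)
    then have "\<epsilon> * deriv s t + (1 - \<epsilon>) * deriv r t = ?G * (sqrt \<alpha>\<^sub>1 / sqrt t)"
      unfolding DERIV_imp_deriv[OF s_deriv[OF that]] DERIV_imp_deriv[OF r_deriv[OF that]]
      by (metis distrib_right mult.assoc times_divide_eq_right)
    moreover have "\<rho> * l * (sqrt \<alpha>\<^sub>1 / sqrt t) = C * (l * sqrt pi / (D * c\<^sub>1))"
    proof -
      have "\<rho> * c\<^sub>1 * (sqrt \<alpha>\<^sub>1 * sqrt \<alpha>\<^sub>1) = k\<^sub>1"
        using pos \<alpha>_pos by (simp add: assms(13))
      then show ?thesis
        using that pos \<alpha>_pos by (simp add: C_def real_sqrt_mult divide_simps) (simp add: mult_ac)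
    qed
    ultimately have rhs: "\<rho> * l * (\<epsilon> * deriv s t + (1 - \<epsilon>) * deriv r t) = C * (l * sqrt pi / (D * c\<^sub>1) * ?G)"
      by (metis mult.assoc mult.commute)
    \<comment> \<open>In the ratio of the two phases the common \<open>sqrt \<rho>\<close> cancels,
      which produces the quotient of square roots in \<open>F_fun\<close>.\<close>
    have "k\<^sub>2 / sqrt \<alpha>\<^sub>2 = sqrt (k\<^sub>2 * c\<^sub>2) * sqrt \<rho>" "k\<^sub>1 / sqrt \<alpha>\<^sub>1 = sqrt (k\<^sub>1 * c\<^sub>1) * sqrt \<rho>"
      using pos by (simp_all add: assms(13,14) real_sqrt_mult real_sqrt_divide divide_simps)
    then have coeff: "k\<^sub>2 / sqrt \<alpha>\<^sub>2 = k\<^sub>1 / sqrt \<alpha>\<^sub>1 * (sqrt (k\<^sub>2 * c\<^sub>2) / sqrt (k\<^sub>1 * c\<^sub>1))"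
      using pos by simp
    have "k\<^sub>2 * q t = k\<^sub>2 / sqrt \<alpha>\<^sub>2 * (\<theta>\<^sub>0 * exp (- (\<mu>\<^sup>2)) / (erfc \<mu> * sqrt pi * sqrt t))"
      by (simp add: q_eq[OF that] real_sqrt_mult mult_ac)
    also have "\<dots> = C * (\<theta>\<^sub>0 * sqrt (k\<^sub>2 * c\<^sub>2) / (D * sqrt (k\<^sub>1 * c\<^sub>1)) * (exp (- (\<mu>\<^sup>2)) / erfc \<mu>))"
      unfolding coeff using pos by (simp add: C_def real_sqrt_mult mult_ac)
    finally have "k\<^sub>1 * p t - k\<^sub>2 * q t = C * ?F"
      unfolding F right_diff_distrib by (simp add: p_eq[OF that] C_def mult_ac)
    then show ?thesis
      unfolding rhs using \<open>0 < C\<close> by (simp only: mult_cancel_left) auto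
  qed

  have interface: "(\<exists>p q. ((\<lambda>x. dx \<theta>\<^sub>1 x t) \<longlongrightarrow> p) (at_left (s t)) \<and>
               ((\<lambda>x. dx \<theta>\<^sub>2 x t) \<longlongrightarrow> q) (at_right (r t)) \<and>
               k\<^sub>1 * p - k\<^sub>2 * q = \<rho> * l * (\<epsilon> * deriv s t + (1 - \<epsilon>) * deriv r t) \<and>
               p * (r t - s t) = \<gamma>) \<longleftrightarrow> ?F = l * sqrt pi / (D * c\<^sub>1) * ?G" (is "?L \<longleftrightarrow> _")
    if "0 < t" for t
  proof -
    \<comment> \<open>Uniqueness of limits forces the witnesses to be \<open>p t\<close> and
      \<open>q t\<close>. As the mushy-zone condition already holds for these, only the flux
      condition is left.\<close>
    have "?L \<longleftrightarrow> ?flux t"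
      using lim_p[OF that] lim_q[OF that] mushy[OF that]
        tendsto_unique[OF trivial_limit_at_left_real lim_p[OF that]]
        tendsto_unique[OF trivial_limit_at_right_real lim_q[OF that]]
      by metis
    then show ?thesis
      unfolding flux_iff[OF that] .
  qed
  have "s differentiable (at t) \<and> r differentiable (at t)" if "0 < t" for t
    using s_deriv[OF that] r_deriv[OF that] by (auto simp: real_differentiable_def)
  moreover have "\<exists>u p. ((\<lambda>x. \<theta>\<^sub>1 x t) \<longlongrightarrow> u) (at_right 0) \<and> ((\<lambda>x. dx \<theta>\<^sub>1 x t) \<longlongrightarrow> p) (at_right 0) \<and>
      k\<^sub>1 * p = h\<^sub>0 / sqrt t * (u + D)" if "0 < t" for t
    using lim_\<theta>\<^sub>1_0[OF that] lim_p0[OF that] convective[OF that] by blast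
  \<comment> \<open>The equation for \<xi> does not involve t; to extract it from a statement about
    all positive times, one such time must exist.\<close>
  moreover have "\<exists>t::real. 0 < t"
    by (rule exI[of _ 1]) simp
  ultimately show ?thesis
    unfolding stefan_mushy_solution_def
    using interface s_pos heat\<^sub>1[unfolded assms(13)] heat\<^sub>2[unfolded assms(14)] s_0 r_0
      lim_\<theta>\<^sub>1_s lim_\<theta>\<^sub>2_r lim_\<theta>\<^sub>2_initial lim_\<theta>\<^sub>2_top
    by auto
qed

end
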